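(* Let $m,n\ge1$ be integers and consider two independent binary sequences over the alphabet $\{0,1\}$, of lengths $m$ and $n$, whose letters are independent and uniformly distributed on $\{0,1\}$. Let $X$ and $Y$ be the numbers of occurrences of the letter $0$ in the first and second sequence respectively, let $D_2=XY+(m-X)(n-Y)$ and let $W=\dfrac{D_2-\mathbb{E}D_2}{\sqrt{\mathrm{Var}D_2}}$. Then $W$ is approximately $\mathrm{VG}_1(1,0,1,0)$ distributed, in the sense that for every $h\in C_b^3(\mathbb{R})$, $$|\mathbb{E}h(W)-\mathrm{VG}^{1,0}_{1,0}h|\le\min\{A,B\},$$ where $$A=\frac9mM^3_{1,1}(h)+\frac1nM^4_{1,1}(h),\qquad B=\frac9nM^3_{1,1}(h)+\frac1mM^4_{1,1}(h).$$
   Context: $\|\cdot\|$ is the supremum norm on $\mathbb{R}$; $C_b^3(\mathbb{R})$ is the set of bounded three times continuously differentiable real functions with bounded derivatives up to order three. $\mathrm{VG}^{1,0}_{1,0}h=\mathbb{E}h(Z)$ where $Z\sim\mathrm{VG}_1(1,0,1,0)$, i.e. $Z$ has density $\frac1\pi K_0(|x|)$ on $\mathbb{R}$ ($K_0$ the modified Bessel function of the second kind of order $0$). With $\tilde h=h-\mathrm{VG}^{1,0}_{1,0}h$ and $c=\sqrt{\pi/2}+1$, $$M_{1,1}^3(h)=c\,[5\|h''\|+18\|h'\|+19\|\tilde h\|],\quad M_{1,1}^4(h)=c\,[8\|h^{(3)}\|+52\|h''\|+124\|h'\|+124\|\tilde h\|].$$ *)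

theory Defs
  imports "HOL-Probability.Probability"
begin

text \<open>Modified Bessel function of the second kind, by its integral representation
  (valid for \<open>x > 0\<close>). At \<open>x = 0\<close>, where the true function is infinite, the Bochner
  integral defaults to 0; this point is a null set for the density below.\<close>
definition besselK :: "real \<Rightarrow> real \<Rightarrow> real" where
  "besselK \<nu> x = (LBINT t:{0..}. exp (- x * cosh t) * cosh (\<nu> * t))"

text \<open>The distribution \<open>VG\<^sub>1(1,0,1,0)\<close>.\<close>
definition VG :: "real measure" where
  "VG = density lborel (\<lambda>x. ennreal (1 / pi * besselK 0 \<bar>x\<bar>))"

definition VG_expect :: "(real \<Rightarrow> real) \<Rightarrow> real" where
  "VG_expect h = integral\<^sup>L VG h"

definition sup_norm :: "(real \<Rightarrow> real) \<Rightarrow> real" where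
  "sup_norm f = (SUP x. \<bar>f x\<bar>)"

definition Cb :: "nat \<Rightarrow> (real \<Rightarrow> real) set" where
  "Cb k = {h. (\<forall>i<k. \<forall>x. (deriv ^^ i) h differentiable at x) \<and>
              (\<forall>i\<le>k. continuous_on UNIV ((deriv ^^ i) h) \<and> bounded (range ((deriv ^^ i) h)))}"

definition M3 :: "(real \<Rightarrow> real) \<Rightarrow> real" where
  "M3 h = (sqrt (pi / 2) + 1) *
     (5 * sup_norm ((deriv ^^ 2) h) + 18 * sup_norm (deriv h)
      + 19 * sup_norm (\<lambda>x. h x - VG_expect h))"

definition M4 :: "(real \<Rightarrow> real) \<Rightarrow> real" where
  "M4 h = (sqrt (pi / 2) + 1) *
     (8 * sup_norm ((deriv ^^ 3) h) + 52 * sup_norm ((deriv ^^ 2) h)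
      + 124 * sup_norm (deriv h) + 124 * sup_norm (\<lambda>x. h x - VG_expect h))"

definition zero_count :: "nat \<Rightarrow> (nat \<Rightarrow> 'a \<Rightarrow> nat) \<Rightarrow> 'a \<Rightarrow> nat" where
  "zero_count k U \<omega> = card {i. i < k \<and> U i \<omega> = 0}"

definition D2 :: "nat \<Rightarrow> nat \<Rightarrow> (nat \<Rightarrow> 'a \<Rightarrow> nat) \<Rightarrow> (nat \<Rightarrow> 'a \<Rightarrow> nat) \<Rightarrow> 'a \<Rightarrow> real" where
  "D2 m n U V \<omega> =
     (let X = real (zero_count m U \<omega>); Y = real (zero_count n V \<omega>)
      in X * Y + (real m - X) * (real n - Y))"

definition standardized :: "'a measure \<Rightarrow> ('a \<Rightarrow> real) \<Rightarrow> 'a \<Rightarrow> real" where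
  "standardized M D \<omega> =
     (D \<omega> - prob_space.expectation M D) / sqrt (prob_space.variance M D)"

text \<open>Two independent sequences of lengths \<open>m\<close> and \<open>n\<close> of independent uniform letters, i.e. all
  \<open>m + n\<close> letters are mutually independent; the disjoint sum indexes the combined family.\<close>
definition uniform_binary_sequences ::
  "'a measure \<Rightarrow> nat \<Rightarrow> nat \<Rightarrow> (nat \<Rightarrow> 'a \<Rightarrow> nat) \<Rightarrow> (nat \<Rightarrow> 'a \<Rightarrow> nat) \<Rightarrow> bool" where
  "uniform_binary_sequences M m n U V \<longleftrightarrow>
     prob_space.indep_vars M (\<lambda>_. count_space {0, 1}) (case_sum U V) ({..<m} <+> {..<n}) \<and>
     (\<forall>i<m. distr M (count_space {0, 1}) (U i) = uniform_count_measure {0, 1}) \<and>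
     (\<forall>j<n. distr M (count_space {0, 1}) (V j) = uniform_count_measure {0, 1})"

end

theory Submission
  imports Defs "HOL-Real_Asymp.Real_Asymp"
begin

text \<open>
  Writing \<open>X\<close> and \<open>Y\<close> as centred sums of signs turns \<open>W\<close> into a product \<open>S T\<close> of two independent
  normalised Rademacher sums, while \<open>VG\<^sub>1(1,0,1,0)\<close> is the law of a product of two independent
  standard normals. Conditionally on the other factor, each Rademacher sum is replaced by a normal
  variable with Stein's method. The sign symmetry makes the Stein discrepancy of a Rademacher sum a
  trapezoidal-rule error, so a bounded third derivative of the Stein solution \<open>f\<close> already gives the
  rate \<open>1/m\<close>. That derivative is bounded because \<open>f''\<close> solves a Stein equation again, with the
  right-hand side \<open>2 f' + h''\<close>. The error obtained,
  \<open>(16 \<parallel>h - VG h\<parallel> + 2 \<parallel>h''\<parallel>) (1/m + 1/n)\<close>, is below both bounds of the theorem.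
\<close>

section \<open>The Stein equation of the normal distribution\<close>

text \<open>The function \<open>R / x\<close> is a supersolution of the equation on the positive
  half-line. Multiplied by the integrating factor \<open>exp (- x^2 / 2)\<close>, its gap to
  \<open>w\<close> decreases towards the limit 0 and is therefore nonnegative. The limit hypothesis
  rules out an added multiple of \<open>exp (x^2 / 2)\<close>, which solves the homogeneous
  equation.\<close>

lemma stein_ode_upper_bound:
  fixes w r :: "real \<Rightarrow> real"
  assumes deriv: "\<And>x. (w has_real_derivative x * w x + r x) (at x)"
    and bound: "\<And>x. \<bar>r x\<bar> \<le> R"
    and lim: "((\<lambda>x. w x * exp (- x\<^sup>2 / 2)) \<longlongrightarrow> 0) at_top"
    and "x > 0"
  shows "w x \<le> R / x"
proof -
  define D where "D y = (R / y - w y) * exp (- y\<^sup>2 / 2)" for y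
  have decreasing: "D y \<le> D x" if "x \<le> y" for y
  proof (rule DERIV_nonpos_imp_nonincreasing[OF that])
    fix z assume "x \<le> z" "z \<le> y"
    then have "z > 0" using \<open>x > 0\<close> by simp
    \<comment> \<open>The terms containing \<open>w z\<close> cancel, so the sign depends only on
      \<open>R\<close> and \<open>r z\<close>.\<close>
    have "(D has_real_derivative (- (R / z\<^sup>2) - (R + r z)) * exp (- z\<^sup>2 / 2)) (at z)"
      unfolding D_def using \<open>z > 0\<close>
      by (auto intro!: derivative_eq_intros deriv simp: field_simps power2_eq_square)
    moreover have "(- (R / z\<^sup>2) - (R + r z)) * exp (- z\<^sup>2 / 2) \<le> 0"
    proof (rule mult_nonpos_nonneg)
      have "R \<ge> 0" "R + r z \<ge> 0" using bound[of z] by auto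
      moreover from \<open>R \<ge> 0\<close> have "R / z\<^sup>2 \<ge> 0" by simp
      ultimately show "- (R / z\<^sup>2) - (R + r z) \<le> 0" by linarith
    qed simp
    ultimately show "\<exists>d. (D has_real_derivative d) (at z) \<and> d \<le> 0" by blast
  qed
  have "((\<lambda>y. R / y * exp (- y\<^sup>2 / 2)) \<longlongrightarrow> 0) at_top" by real_asymp
  from tendsto_diff[OF this lim] have "(D \<longlongrightarrow> 0) at_top"
    by (simp add: D_def[abs_def] left_diff_distrib)
  then have "0 \<le> D x"
    by (rule tendsto_upperbound) (auto intro: eventually_mono[OF eventually_ge_at_top[of x]] decreasing)
  then show ?thesis by (simp add: D_def zero_le_mult_iff)
qed

text \<open>The upper bound is applied to \<open>w\<close> and \<open>- w\<close>; for negative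
  arguments it is applied to the reflection of \<open>w\<close>, which solves the same equation with
  right-hand side \<open>- r (- x)\<close>. The constant does not depend on \<open>x\<close>, so the
  coefficient \<open>x\<close> costs nothing in later derivative bounds.\<close>

lemma stein_ode_bound:
  fixes w r :: "real \<Rightarrow> real"
  assumes deriv: "\<And>x. (w has_real_derivative x * w x + r x) (at x)"
    and bound: "\<And>x. \<bar>r x\<bar> \<le> R"
    and top: "((\<lambda>x. w x * exp (- x\<^sup>2 / 2)) \<longlongrightarrow> 0) at_top"
    and bot: "((\<lambda>x. w x * exp (- x\<^sup>2 / 2)) \<longlongrightarrow> 0) at_bot"
  shows "\<bar>x * w x\<bar> \<le> R"
proof -
  have half_line: "\<bar>x * v x\<bar> \<le> R"
    if "\<And>x. (v has_real_derivative x * v x + s x) (at x)" "\<And>x. \<bar>s x\<bar> \<le> R"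
      "((\<lambda>x. v x * exp (- x\<^sup>2 / 2)) \<longlongrightarrow> 0) at_top" "x > 0" for v s :: "real \<Rightarrow> real" and x
  proof -
    have "v x \<le> R / x" by (rule stein_ode_upper_bound) (use that in auto)
    moreover have "- v x \<le> R / x"
      by (rule stein_ode_upper_bound[where r = "\<lambda>x. - s x"])
        (use that tendsto_minus[OF that(3)] in \<open>auto intro!: derivative_eq_intros that\<close>)
    ultimately show ?thesis using \<open>x > 0\<close> by (auto simp: field_simps abs_le_iff)
  qed
  consider "x > 0" | "x = 0" | "x < 0" by linarith
  then show ?thesis
  proof cases
    case 1
    then show ?thesis using half_line[OF deriv bound top] by blast
  next
    case 2
    then show ?thesis using bound[of 0] by simp
  next
    case 3
    have "((\<lambda>x. w (- x)) has_real_derivative x * w (- x) + - r (- x)) (at x)" for x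
      by (rule DERIV_cong[OF DERIV_chain'[OF DERIV_minus[OF DERIV_ident] deriv]]) simp
    moreover have "((\<lambda>x. w (- x) * exp (- x\<^sup>2 / 2)) \<longlongrightarrow> 0) at_top"
      using bot by (simp add: filterlim_at_bot_mirror)
    ultimately have "\<bar>(- x) * w (- (- x))\<bar> \<le> R"
      using 3 bound by (intro half_line[where s = "\<lambda>x. - r (- x)"]) auto
    then show ?thesis by simp
  qed
qed

section \<open>Existence and smoothness of the Stein solution\<close>

text \<open>Integrating from minus infinity gives the limit 0 at the left end; the vanishing total
  integral gives it at the right end too. These limits are the boundary conditions of
  \<open>stein_ode_bound\<close>.\<close>

lemma primitive_vanishing_at_infinity:
  fixes q :: "real \<Rightarrow> real"
  assumes cont: "continuous_on UNIV q" and int: "integrable lborel q" and zero: "(LBINT x. q x) = 0"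
  obtains P where "\<And>x. (P has_real_derivative q x) (at x)" "(P \<longlongrightarrow> 0) at_top" "(P \<longlongrightarrow> 0) at_bot"
proof
  define P where "P x = (LBINT t. indicator {..x} t *\<^sub>R q t)" for x
  have int_on: "integrable lborel (\<lambda>t. indicator A t *\<^sub>R q t)" if "A \<in> sets borel" for A
    using integrable_mult_indicator[OF _ int] that by simp
  \<comment> \<open>Increments of \<open>P\<close> are integrals over compact intervals, to which
    the fundamental theorem of calculus applies. The half-open and closed intervals differ by a null
    set.\<close>
  have P_diff: "P y = P a + integral {a..y} q" if "a \<le> y" for a y
  proof -
    have "P y - P a = (LBINT t. indicator {..y} t *\<^sub>R q t - indicator {..a} t *\<^sub>R q t)"
      unfolding P_def by (intro Bochner_Integration.integral_diff[symmetric] int_on) auto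
    also have "\<dots> = (LBINT t. indicator {a<..y} t *\<^sub>R q t)"
      using that by (intro Bochner_Integration.integral_cong) (auto simp: indicator_def)
    also have "\<dots> = (LBINT t:{a..y}. q t)"
      unfolding set_lebesgue_integral_def
      by (intro integral_cong_AE) (use AE_lborel_singleton[of a] int in \<open>auto simp: indicator_def\<close>)
    also have "\<dots> = integral {a..y} q"
      by (intro set_borel_integral_eq_integral) (simp only: set_integrable_def int_on[of "{a..y}"] atLeastAtMost_borel)
    finally show ?thesis by simp
  qed
  show "(P has_real_derivative q x) (at x)" for x
  proof -
    have "((\<lambda>y. integral {x - 1..y} q) has_real_derivative q x) (at x within {x - 1..x + 1})"
      by (rule integral_has_real_derivative) (auto intro: continuous_on_subset[OF cont])
    then have "((\<lambda>y. P (x - 1) + integral {x - 1..y} q) has_real_derivative q x) (at x within {x - 1..x + 1})"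
      by (auto intro!: derivative_eq_intros)
    then have "(P has_real_derivative q x) (at x within {x - 1..x + 1})"
      by (rule has_field_derivative_transform_within[OF _ zero_less_one]) (auto simp: P_diff)
    then show ?thesis by (simp add: at_within_Icc_at)
  qed
  show "(P \<longlongrightarrow> 0) at_top"
    unfolding P_def using tendsto_integral_at_top[OF _ int] zero by simp
  show "(P \<longlongrightarrow> 0) at_bot"
  proof -
    \<comment> \<open>Reflection reduces the left limit to a limit at \<open>at_top\<close>:
      \<open>P (- y)\<close> is the integral of \<open>q (- t)\<close> over
      \<open>t \<ge> y\<close>, which by the zero mean is minus the integral over
      \<open>t \<le> y\<close>.\<close>
    have int': "integrable lborel (\<lambda>t. q (- t))" and zero': "(LBINT t. q (- t)) = 0"
      using lborel_integrable_real_affine_iff[of "-1" q 0] int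
        lborel_integral_real_affine[of "-1" q 0] zero by auto
    have "P (- y) = - (LBINT t. indicator {..y} t *\<^sub>R q (- t))" for y
    proof -
      have "P (- y) = (LBINT t. indicator {..- y} (- t) *\<^sub>R q (- t))"
        unfolding P_def using lborel_integral_real_affine[of "-1" "\<lambda>t. indicator {..- y} t *\<^sub>R q t" 0] by simp
      also have "\<dots> = (LBINT t. q (- t) - indicator {..y} t *\<^sub>R q (- t))"
        by (intro integral_cong_AE) (use AE_lborel_singleton[of y] int' in \<open>auto simp: indicator_def\<close>)
      also have "\<dots> = - (LBINT t. indicator {..y} t *\<^sub>R q (- t))"
        using integrable_mult_indicator[OF _ int', of "{..y}"] int' zero'
        by (subst Bochner_Integration.integral_diff) auto
      finally show ?thesis .
    qed
    then show ?thesis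
      using tendsto_minus[OF tendsto_integral_at_top[OF _ int']] zero'
      by (simp add: filterlim_at_bot_mirror)
  qed
qed

text \<open>The chain of bounds is \<open>\<bar>x * f x\<bar> \<le> A\<close>, then
  \<open>\<bar>f' x\<bar> \<le> 2 * A\<close> from the equation, then
  \<open>\<bar>x * f'' x\<bar> \<le> 4 * A + C\<close> from the Stein equation solved by
  \<open>f''\<close>, whose right-hand side is at most \<open>4 * A + C\<close>. The derivative of
  \<open>f''\<close> is the sum of the last two quantities. The bound \<open>B\<close> enters only
  the growth of \<open>f''\<close> at infinity, hence not the constant.\<close>

lemma normal_stein_solution:
  fixes g g' g'' :: "real \<Rightarrow> real"
  defines "\<mu> \<equiv> (LINT x|std_normal_distribution. g x)"
  assumes dg: "\<And>x. (g has_real_derivative g' x) (at x)"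
    and dg': "\<And>x. (g' has_real_derivative g'' x) (at x)"
    and A: "\<And>x. \<bar>g x - \<mu>\<bar> \<le> A" and B: "\<And>x. \<bar>g' x\<bar> \<le> B" and C: "\<And>x. \<bar>g'' x\<bar> \<le> C"
  obtains f f' f'' where "\<forall>x. (f has_real_derivative f' x) (at x)"
    and "\<forall>x. (f' has_real_derivative f'' x) (at x)"
    and "\<forall>x y. \<bar>f'' x - f'' y\<bar> \<le> (8 * A + 2 * C) * \<bar>x - y\<bar>"
    and "\<forall>x. f' x - x * f x = g x - \<mu>"
proof -
  interpret N: real_distribution std_normal_distribution by (rule real_dist_normal_dist)
  have cont_g: "continuous_on UNIV g" by (rule DERIV_continuous_on[OF dg]) 
  have [measurable]: "g \<in> borel_measurable borel" by (rule borel_measurable_continuous_onI[OF cont_g])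
  define q where "q x = (g x - \<mu>) * exp (- x\<^sup>2 / 2)" for x
  have q_eq: "q x = sqrt (2 * pi) * (std_normal_density x * (g x - \<mu>))" for x
    by (simp add: q_def std_normal_density_def)
  have int: "integrable std_normal_distribution (\<lambda>x. g x - \<mu>)"
    by (rule N.integrable_const_bound[where B = A]) (use A in auto)
  have "(LINT x|std_normal_distribution. g x - \<mu>) = 0"
  proof -
    \<comment> \<open>Integrability of \<open>g\<close> makes \<open>\<mu>\<close> its true mean
      rather than the default value of a Bochner integral.\<close>
    have "integrable std_normal_distribution (\<lambda>x. (g x - \<mu>) + \<mu>)"
      by (intro Bochner_Integration.integrable_add int N.integrable_const)
    moreover have "N.prob UNIV = 1" using N.prob_space by simp
    ultimately show ?thesis by (simp add: \<mu>_def)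
  qed
  then have "(LBINT x. q x) = 0"
    unfolding q_eq by (subst (asm) integral_density) auto
  moreover have "integrable lborel q"
    unfolding q_eq using int by (subst (asm) integrable_density) auto
  moreover have "continuous_on UNIV q"
    unfolding q_def by (intro continuous_intros cont_g) auto
  ultimately obtain P where P: "\<And>x. (P has_real_derivative q x) (at x)"
    "(P \<longlongrightarrow> 0) at_top" "(P \<longlongrightarrow> 0) at_bot"
    using primitive_vanishing_at_infinity by blast
  define f where "f x = P x * exp (x\<^sup>2 / 2)" for x
  define f' where "f' x = x * f x + (g x - \<mu>)" for x
  define f'' where "f'' x = f x + x * f' x + g' x" for x
  have f: "(f has_real_derivative f' x) (at x)" for x
    unfolding f_def f'_def
    by (auto intro!: derivative_eq_intros P simp: q_def exp_minus exp_add[symmetric] mult_exp_exp field_simps)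
  have f': "(f' has_real_derivative f'' x) (at x)" for x
    unfolding f'_def f''_def by (auto intro!: derivative_eq_intros f dg simp: f'_def)
  \<comment> \<open>Differentiating \<open>f' = x f + (g - \<mu>)\<close> twice reproduces the same
    type of equation, with \<open>2 f' + g''\<close> on the right.\<close>
  have f'': "(f'' has_real_derivative x * f'' x + (2 * f' x + g'' x)) (at x)" for x
    unfolding f''_def[abs_def] by (auto intro!: derivative_eq_intros f f' dg' simp: f''_def)
  have weighted: "f x * exp (- x\<^sup>2 / 2) = P x" for x
    by (simp add: f_def mult.assoc mult_exp_exp)
  have xf: "\<bar>x * f x\<bar> \<le> A" for x
    by (rule stein_ode_bound[where r = "\<lambda>x. g x - \<mu>"]) (use f A P weighted in \<open>auto simp: f'_def\<close>)
  then have f'_bound: "\<bar>f' x\<bar> \<le> 2 * A" for x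
    using A[of x] xf[of x] unfolding f'_def by linarith
  \<comment> \<open>Outside the unit interval
    \<open>\<bar>f x\<bar> \<le> \<bar>x * f x\<bar> \<le> A\<close>. Linear growth of
    \<open>f''\<close> is enough for its Gaussian-weighted version to vanish at both ends.\<close>
  have growth: "\<bar>f'' x\<bar> \<le> A + B + 2 * A * \<bar>x\<bar>" if "\<bar>x\<bar> \<ge> 1" for x
  proof -
    have "\<bar>f x\<bar> \<le> \<bar>x\<bar> * \<bar>f x\<bar>" using mult_right_mono[OF that, of "\<bar>f x\<bar>"] by simp
    also have "\<dots> \<le> A" using xf[of x] by (simp add: abs_mult)
    finally have "\<bar>f x\<bar> \<le> A" .
    moreover have "\<bar>x * f' x\<bar> \<le> 2 * A * \<bar>x\<bar>"
      using mult_right_mono[OF f'_bound[of x], of "\<bar>x\<bar>"] by (simp add: abs_mult mult.commute)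
    ultimately show ?thesis using B[of x] unfolding f''_def by linarith
  qed
  have top: "((\<lambda>x. f'' x * exp (- x\<^sup>2 / 2)) \<longlongrightarrow> 0) at_top"
  proof (rule Lim_null_comparison)
    show "((\<lambda>x. (A + B + 2 * A * \<bar>x\<bar>) * exp (- x\<^sup>2 / 2)) \<longlongrightarrow> 0) at_top" by real_asymp
    show "\<forall>\<^sub>F x in at_top. norm (f'' x * exp (- x\<^sup>2 / 2)) \<le> (A + B + 2 * A * \<bar>x\<bar>) * exp (- x\<^sup>2 / 2)"
      using eventually_ge_at_top[of 1]
    proof eventually_elim
      case (elim x)
      then show ?case using growth[of x] by (simp add: abs_mult)
    qed
  qed
  have bot: "((\<lambda>x. f'' x * exp (- x\<^sup>2 / 2)) \<longlongrightarrow> 0) at_bot"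
  proof (rule Lim_null_comparison)
    show "((\<lambda>x. (A + B + 2 * A * \<bar>x\<bar>) * exp (- x\<^sup>2 / 2)) \<longlongrightarrow> 0) at_bot" by real_asymp
    show "\<forall>\<^sub>F x in at_bot. norm (f'' x * exp (- x\<^sup>2 / 2)) \<le> (A + B + 2 * A * \<bar>x\<bar>) * exp (- x\<^sup>2 / 2)"
      using eventually_le_at_bot[of "-1"]
    proof eventually_elim
      case (elim x)
      then show ?case using growth[of x] by (simp add: abs_mult)
    qed
  qed
  have r: "\<bar>2 * f' x + g'' x\<bar> \<le> 4 * A + C" for x using f'_bound[of x] C[of x] by linarith
  have xf'': "\<bar>x * f'' x\<bar> \<le> 4 * A + C" for x
    by (rule stein_ode_bound[OF f'' r top bot])
  have "\<bar>x * f'' x + (2 * f' x + g'' x)\<bar> \<le> 8 * A + 2 * C" for x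
    using xf''[of x] r[of x] by linarith
  then have "norm (f'' x - f'' y) \<le> (8 * A + 2 * C) * norm (x - y)" for x y
    by (intro field_differentiable_bound[of UNIV f'' "\<lambda>x. x * f'' x + (2 * f' x + g'' x)"])
      (use f'' in auto)
  then show thesis using that[of f f' f''] f f' by (simp add: f'_def)
qed

text \<open>As a function of the half-width \<open>z\<close> the error vanishes at 0 and has
  derivative \<open>- z * (f'' (x + z) - f'' (x - z))\<close>: the first-order terms cancel by
  symmetry. The mean value theorem and the Lipschitz bound on \<open>f''\<close> then give cubic
  order.\<close>

lemma trapezoid_error:
  fixes f f' f'' :: "real \<Rightarrow> real"
  assumes f: "\<And>x. (f has_real_derivative f' x) (at x)"
    and f': "\<And>x. (f' has_real_derivative f'' x) (at x)"
    and lip: "\<And>x y. \<bar>f'' x - f'' y\<bar> \<le> L * \<bar>x - y\<bar>" and "a > 0"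
  shows "\<bar>f (x + a) - f (x - a) - a * (f' (x + a) + f' (x - a))\<bar> \<le> 2 * L * a ^ 3"
proof -
  define F where "F z = f (x + z) - f (x - z) - z * (f' (x + z) + f' (x - z))" for z
  have "(F has_real_derivative - z * (f'' (x + z) - f'' (x - z))) (at z)" for z
    unfolding F_def
    by (auto intro!: derivative_eq_intros DERIV_chain2[of f] DERIV_chain2[of f'] f f' simp: algebra_simps)
  from MVT2[OF \<open>a > 0\<close> this] obtain z where z: "0 < z" "z < a"
    "F a - F 0 = (a - 0) * (- z * (f'' (x + z) - f'' (x - z)))" by blast
  have "L \<ge> 0" using order_trans[OF abs_ge_zero lip[of 1 0]] by simp
  have "\<bar>f'' (x + z) - f'' (x - z)\<bar> \<le> 2 * L * z" using lip[of "x + z" "x - z"] z by simp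
  then have "\<bar>F a\<bar> \<le> a * (z * (2 * L * z))"
    using z \<open>a > 0\<close> by (simp add: F_def abs_mult)
  also have "\<dots> \<le> a * (a * (2 * L * a))"
    using z \<open>a > 0\<close> \<open>L \<ge> 0\<close> by (intro mult_left_mono mult_mono) auto
  finally show ?thesis by (simp add: F_def power3_eq_cube mult_ac)
qed

section \<open>Rademacher sums\<close>

text \<open>The Stein solution comes without a bound on the whole line, but a bounded
  \<open>Z\<close> sees it only on a compact interval, where continuity bounds it.\<close>

lemma (in prob_space) integrable_continuous_bounded:
  fixes Z :: "'a \<Rightarrow> real" and \<phi> :: "real \<Rightarrow> real"
  assumes [measurable]: "random_variable borel Z" and Z: "\<And>\<omega>. \<omega> \<in> space M \<Longrightarrow> \<bar>Z \<omega>\<bar> \<le> K"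
    and cont: "continuous_on UNIV \<phi>"
  shows "integrable M (\<lambda>\<omega>. \<phi> (Z \<omega>))"
proof -
  have [measurable]: "\<phi> \<in> borel_measurable borel" by (rule borel_measurable_continuous_onI[OF cont])
  have "compact (\<phi> ` {- K..K})"
    by (rule compact_continuous_image) (auto intro: continuous_on_subset[OF cont])
  then obtain b where b: "\<And>x. x \<in> {- K..K} \<Longrightarrow> norm (\<phi> x) \<le> b"
    by (meson bounded_iff compact_imp_bounded image_eqI)
  show ?thesis
  proof (rule integrable_const_bound[where B = b])
    show "AE \<omega> in M. norm (\<phi> (Z \<omega>)) \<le> b"
      by (intro AE_I2 b) (use Z in \<open>force simp: abs_le_iff\<close>)
  qed measurable
qed

text \<open>When \<open>X\<close> is a sign, the weights \<open>(1 + X) / 2\<close> and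
  \<open>(1 - X) / 2\<close> are the indicators of its two values. Each has mean 1/2 and, by
  independence, factors out of the expectation.\<close>

lemma (in prob_space) expectation_fair_sign:
  fixes X R :: "'a \<Rightarrow> real" and p q :: "real \<Rightarrow> real"
  assumes indep: "indep_var borel X borel R"
    and X: "\<And>\<omega>. \<omega> \<in> space M \<Longrightarrow> \<bar>X \<omega>\<bar> \<le> 1" "expectation X = 0"
    and [measurable]: "p \<in> borel_measurable borel" "q \<in> borel_measurable borel"
    and int: "integrable M (\<lambda>\<omega>. p (R \<omega>))" "integrable M (\<lambda>\<omega>. q (R \<omega>))"
  shows "expectation (\<lambda>\<omega>. (1 + X \<omega>) / 2 * p (R \<omega>) + (1 - X \<omega>) / 2 * q (R \<omega>))
    = expectation (\<lambda>\<omega>. p (R \<omega>) + q (R \<omega>)) / 2"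
proof -
  have [measurable]: "random_variable borel X" using indep by (rule indep_var_rv1)
  have intX: "integrable M X"
    by (rule integrable_const_bound[where B = 1]) (use X in auto)
  have *: "integrable M (\<lambda>\<omega>. (1 + c * X \<omega>) / 2 * s (R \<omega>))"
    "expectation (\<lambda>\<omega>. (1 + c * X \<omega>) / 2 * s (R \<omega>)) = expectation (\<lambda>\<omega>. s (R \<omega>)) / 2"
    if [measurable]: "s \<in> borel_measurable borel" and s: "integrable M (\<lambda>\<omega>. s (R \<omega>))" for c s
  proof -
    have ind: "indep_var borel (\<lambda>\<omega>. (1 + c * X \<omega>) / 2) borel (\<lambda>\<omega>. s (R \<omega>))"
      using indep_var_compose[OF indep, of "\<lambda>x. (1 + c * x) / 2" borel s borel] by (simp add: comp_def)
    have i: "integrable M (\<lambda>\<omega>. (1 + c * X \<omega>) / 2)" using intX by simp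
    have e: "expectation (\<lambda>\<omega>. (1 + c * X \<omega>) / 2) = 1 / 2"
      using intX X(2) prob_space by simp
    show "integrable M (\<lambda>\<omega>. (1 + c * X \<omega>) / 2 * s (R \<omega>))"
      by (rule indep_var_integrable[OF ind i s])
    show "expectation (\<lambda>\<omega>. (1 + c * X \<omega>) / 2 * s (R \<omega>)) = expectation (\<lambda>\<omega>. s (R \<omega>)) / 2"
      using indep_var_lebesgue_integral[OF ind i s] e by simp
  qed
  show ?thesis
    using *[of p 1] *[of q "-1"] int by (simp add: Bochner_Integration.integral_add add_divide_distrib)
qed

text \<open>With one sign removed, \<open>S = R + a * X i\<close> where \<open>R\<close> is
  independent of \<open>X i\<close>. Averaging over that sign turns its share of
  \<open>S * f S - f' S\<close> into \<open>a / 2\<close> times a trapezoidal error, which is at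
  most \<open>L * a ^ 4\<close>. Since \<open>card I * a^2 = 1\<close>, the total is
  \<open>L * a^2 = L / card I\<close>.\<close>

lemma (in prob_space) rademacher_sum_stein_error:
  fixes I :: "'i set" and X :: "'i \<Rightarrow> 'a \<Rightarrow> real" and f f' f'' :: "real \<Rightarrow> real"
  defines "S \<equiv> \<lambda>\<omega>. (\<Sum>i\<in>I. X i \<omega>) / sqrt (card I)"
  assumes I: "finite I" "I \<noteq> {}" and indep: "indep_vars (\<lambda>_. borel) X I"
    and sign: "\<And>i \<omega>. i \<in> I \<Longrightarrow> \<omega> \<in> space M \<Longrightarrow> X i \<omega> \<in> {-1, 1}"
    and mean: "\<And>i. i \<in> I \<Longrightarrow> expectation (X i) = 0"
    and f: "\<And>x. (f has_real_derivative f' x) (at x)"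
    and f': "\<And>x. (f' has_real_derivative f'' x) (at x)"
    and lip: "\<And>x y. \<bar>f'' x - f'' y\<bar> \<le> L * \<bar>x - y\<bar>"
  shows "\<bar>expectation (\<lambda>\<omega>. S \<omega> * f (S \<omega>) - f' (S \<omega>))\<bar> \<le> L / card I"
proof -
  define a where "a = 1 / sqrt (card I)"
  have "card I > 0" using I by (simp add: card_gt_0_iff)
  then have "a > 0" and a2: "card I * a\<^sup>2 = 1" by (simp_all add: a_def power_divide)
  have S: "S \<omega> = a * (\<Sum>i\<in>I. X i \<omega>)" for \<omega> by (simp add: S_def a_def)
  have X_rv [measurable]: "random_variable borel (X i)" if "i \<in> I" for i
    using indep that by (simp add: indep_vars_def2)
  have sum_bound: "\<bar>a * (\<Sum>i\<in>J. X i \<omega>)\<bar> \<le> a * card I" if "J \<subseteq> I" "\<omega> \<in> space M" for J \<omega>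
  proof -
    have "\<bar>\<Sum>i\<in>J. X i \<omega>\<bar> \<le> (\<Sum>i\<in>J. \<bar>X i \<omega>\<bar>)" by (rule sum_abs)
    also have "\<dots> \<le> (\<Sum>i\<in>J. 1)" by (intro sum_mono) (use sign that in fastforce)
    also have "\<dots> \<le> card I" using card_mono[OF I(1) that(1)] by simp
    finally show ?thesis using \<open>a > 0\<close> by (simp add: abs_mult)
  qed
  have S_rv [measurable]: "random_variable borel (\<lambda>\<omega>. a * (\<Sum>i\<in>J. X i \<omega>))" if "J \<subseteq> I" for J
    using that by (intro borel_measurable_times borel_measurable_const borel_measurable_sum X_rv) auto
  have cont: "continuous_on UNIV f" "continuous_on UNIV f'"
    by (rule DERIV_continuous_on[OF f], rule DERIV_continuous_on[OF f'])
  \<comment> \<open>The factor \<open>a^2\<close> splits \<open>f' (S \<omega>)\<close> into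
    \<open>card I\<close> equal shares, one for each sign.\<close>
  define \<psi> where "\<psi> i \<omega> = a * X i \<omega> * f (S \<omega>) - a\<^sup>2 * f' (S \<omega>)" for i \<omega>
  have summand: "integrable M (\<psi> i) \<and> \<bar>expectation (\<psi> i)\<bar> \<le> a ^ 4 * L" if i: "i \<in> I" for i
  proof -
    define R where "R \<omega> = a * (\<Sum>j\<in>I - {i}. X j \<omega>)" for \<omega>
    \<comment> \<open>\<open>p\<close> and \<open>q\<close> are the values of the summand at
      \<open>X i = 1\<close> and \<open>X i = -1\<close>, as functions of the remaining sum.\<close>
    define p where "p s = a * f (s + a) - a\<^sup>2 * f' (s + a)" for s
    define q where "q s = - a * f (s - a) - a\<^sup>2 * f' (s - a)" for s
    have cont_pq: "continuous_on UNIV p" "continuous_on UNIV q"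
      unfolding p_def q_def
      by (auto intro!: continuous_intros continuous_on_compose2[OF cont(1)] continuous_on_compose2[OF cont(2)])
    then have [measurable]: "p \<in> borel_measurable borel" "q \<in> borel_measurable borel"
      by (auto intro: borel_measurable_continuous_onI)
    have R_rv [measurable]: "random_variable borel R" unfolding R_def by (rule S_rv) auto
    have R_bound: "\<omega> \<in> space M \<Longrightarrow> \<bar>R \<omega>\<bar> \<le> a * card I" for \<omega>
      unfolding R_def by (rule sum_bound) auto
    have int_pq: "integrable M (\<lambda>\<omega>. p (R \<omega>))" "integrable M (\<lambda>\<omega>. q (R \<omega>))"
      by (intro integrable_continuous_bounded[OF R_rv R_bound] cont_pq; assumption)+
    have SR: "S \<omega> = R \<omega> + a * X i \<omega>" for \<omega>
      unfolding S R_def using sum.remove[OF I(1) i, of "\<lambda>i. X i \<omega>"] by (simp add: algebra_simps)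
    have \<psi>: "\<psi> i \<omega> = (1 + X i \<omega>) / 2 * p (R \<omega>) + (1 - X i \<omega>) / 2 * q (R \<omega>)" if "\<omega> \<in> space M" for \<omega>
      using sign[OF i that] by (auto simp: \<psi>_def SR p_def q_def)
    have "indep_var borel (X i) borel (\<lambda>\<omega>. \<Sum>j\<in>I - {i}. X j \<omega>)"
      by (rule indep_vars_sum) (use I i indep in \<open>auto simp: insert_absorb\<close>)
    from indep_var_compose[OF this, of "\<lambda>x. x" borel "\<lambda>x. a * x" borel]
    have ind: "indep_var borel (X i) borel R" by (simp add: comp_def R_def[abs_def])
    have "expectation (\<psi> i) = expectation (\<lambda>\<omega>. (1 + X i \<omega>) / 2 * p (R \<omega>) + (1 - X i \<omega>) / 2 * q (R \<omega>))"
      by (intro Bochner_Integration.integral_cong refl \<psi>)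
    also have "\<dots> = expectation (\<lambda>\<omega>. p (R \<omega>) + q (R \<omega>)) / 2"
    proof (rule expectation_fair_sign[OF ind _ mean[OF i]])
      show "\<bar>X i \<omega>\<bar> \<le> 1" if "\<omega> \<in> space M" for \<omega>
        using sign[OF i that] by auto
    qed (use int_pq in auto)
    finally have eq: "expectation (\<psi> i) = expectation (\<lambda>\<omega>. p (R \<omega>) + q (R \<omega>)) / 2" .
    have pq: "\<bar>p s + q s\<bar> \<le> 2 * L * a ^ 4" for s
    proof -
      have "p s + q s = a * (f (s + a) - f (s - a) - a * (f' (s + a) + f' (s - a)))"
        by (simp add: p_def q_def algebra_simps power2_eq_square)
      also have "\<bar>\<dots>\<bar> \<le> a * (2 * L * a ^ 3)"
        using mult_left_mono[OF trapezoid_error[OF f f' lip \<open>a > 0\<close>, of s], of a] \<open>a > 0\<close>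
        by (simp add: abs_mult)
      finally show ?thesis by (simp add: power_numeral_reduce mult_ac)
    qed
    have "\<bar>expectation (\<lambda>\<omega>. p (R \<omega>) + q (R \<omega>))\<bar> \<le> expectation (\<lambda>\<omega>. \<bar>p (R \<omega>) + q (R \<omega>)\<bar>)"
      by (rule integral_abs_bound)
    also have "\<dots> \<le> 2 * L * a ^ 4"
      by (rule integral_le_const) (use int_pq pq in auto)
    finally have "\<bar>expectation (\<psi> i)\<bar> \<le> a ^ 4 * L"
      unfolding eq by (simp add: mult.commute mult.left_commute)
    moreover have "integrable M (\<psi> i)"
    proof (subst Bochner_Integration.integrable_cong[OF refl \<psi>])
      have "integrable M (\<lambda>\<omega>. X i \<omega> * r (R \<omega>))" if "integrable M (\<lambda>\<omega>. r (R \<omega>))" for r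
      proof (rule Bochner_Integration.integrable_bound[OF that])
        show "(\<lambda>\<omega>. X i \<omega> * r (R \<omega>)) \<in> borel_measurable M"
          using that i by (intro borel_measurable_times X_rv borel_measurable_integrable)
        show "AE \<omega> in M. norm (X i \<omega> * r (R \<omega>)) \<le> norm (r (R \<omega>))"
          by (intro AE_I2) (use sign[OF i] in \<open>force simp: abs_mult\<close>)
      qed
      from this[of p] this[of q] int_pq
      show "integrable M (\<lambda>\<omega>. (1 + X i \<omega>) / 2 * p (R \<omega>) + (1 - X i \<omega>) / 2 * q (R \<omega>))"
        by (simp add: algebra_simps add_divide_distrib diff_divide_distrib)
    qed auto
    ultimately show ?thesis by blast
  qed
  have "S \<omega> * f (S \<omega>) - f' (S \<omega>) = (\<Sum>i\<in>I. \<psi> i \<omega>)" for \<omega>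
  proof -
    have "(\<Sum>i\<in>I. \<psi> i \<omega>) = S \<omega> * f (S \<omega>) - card I * a\<^sup>2 * f' (S \<omega>)"
      by (simp add: \<psi>_def sum_subtractf S sum_distrib_left sum_distrib_right)
    then show ?thesis using a2 by simp
  qed
  then have "\<bar>expectation (\<lambda>\<omega>. S \<omega> * f (S \<omega>) - f' (S \<omega>))\<bar> = \<bar>\<Sum>i\<in>I. expectation (\<psi> i)\<bar>"
    using summand by (simp add: Bochner_Integration.integral_sum)
  also have "\<dots> \<le> (\<Sum>i\<in>I. a ^ 4 * L)"
    by (rule order_trans[OF sum_abs sum_mono]) (use summand in auto)
  also have "\<dots> = (card I * a\<^sup>2) * a\<^sup>2 * L" by (simp add: power_numeral_reduce power2_eq_square)
  also have "\<dots> = L / card I" using a2 \<open>card I > 0\<close> by (simp add: a_def power_divide)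
  finally show ?thesis .
qed

text \<open>Inserting the Stein solution for \<open>g\<close> turns the distance of means into minus
  the Stein error of the sum; \<open>8 * A + 2 * C\<close> is the Lipschitz constant of
  \<open>f''\<close>.\<close>

theorem (in prob_space) rademacher_sum_normal_approximation:
  fixes I :: "'i set" and X :: "'i \<Rightarrow> 'a \<Rightarrow> real" and g g' g'' :: "real \<Rightarrow> real"
  defines "S \<equiv> \<lambda>\<omega>. (\<Sum>i\<in>I. X i \<omega>) / sqrt (card I)"
    and "\<mu> \<equiv> (LINT x|std_normal_distribution. g x)"
  assumes I: "finite I" "I \<noteq> {}" and indep: "indep_vars (\<lambda>_. borel) X I"
    and sign: "\<And>i \<omega>. i \<in> I \<Longrightarrow> \<omega> \<in> space M \<Longrightarrow> X i \<omega> \<in> {-1, 1}"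
    and mean: "\<And>i. i \<in> I \<Longrightarrow> expectation (X i) = 0"
    and dg: "\<And>x. (g has_real_derivative g' x) (at x)"
    and dg': "\<And>x. (g' has_real_derivative g'' x) (at x)"
    and A: "\<And>x. \<bar>g x - \<mu>\<bar> \<le> A" and B: "\<And>x. \<bar>g' x\<bar> \<le> B" and C: "\<And>x. \<bar>g'' x\<bar> \<le> C"
  shows "\<bar>expectation (\<lambda>\<omega>. g (S \<omega>)) - \<mu>\<bar> \<le> (8 * A + 2 * C) / card I"
proof -
  obtain f f' f'' where df: "\<forall>x. (f has_real_derivative f' x) (at x)"
    and df': "\<forall>x. (f' has_real_derivative f'' x) (at x)"
    and lip: "\<forall>x y. \<bar>f'' x - f'' y\<bar> \<le> (8 * A + 2 * C) * \<bar>x - y\<bar>"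
    and f: "\<forall>x. f' x - x * f x = g x - \<mu>"
    by (rule normal_stein_solution[OF dg dg' A[unfolded \<mu>_def] B C, folded \<mu>_def])
  have X_rv [measurable]: "random_variable borel (X i)" if "i \<in> I" for i
    using indep that by (simp add: indep_vars_def2)
  have [measurable]: "random_variable borel S" unfolding S_def by measurable
  have [measurable]: "g \<in> borel_measurable borel"
    by (rule borel_measurable_continuous_onI[OF DERIV_continuous_on[OF dg]])
  have "\<bar>g x\<bar> \<le> A + \<bar>\<mu>\<bar>" for x using A[of x] by linarith
  then have "integrable M (\<lambda>\<omega>. g (S \<omega>))"
    by (intro integrable_const_bound[where B = "A + \<bar>\<mu>\<bar>"] AE_I2) auto
  then have "expectation (\<lambda>\<omega>. g (S \<omega>)) - \<mu> = expectation (\<lambda>\<omega>. g (S \<omega>) - \<mu>)"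
    by (simp add: prob_space)
  also have "\<dots> = - expectation (\<lambda>\<omega>. S \<omega> * f (S \<omega>) - f' (S \<omega>))"
    by (simp add: f[rule_format, symmetric] flip: Bochner_Integration.integral_minus)
  finally show ?thesis
    using rademacher_sum_stein_error[OF I indep sign mean df[rule_format] df'[rule_format] lip[rule_format]]
    by (simp add: S_def)
qed

text \<open>For the identity in place of \<open>f\<close>, the second derivative is 0, so the Stein
  error bound holds with \<open>L = 0\<close> and becomes the exact identity for the second moment.
  No double sum has to be expanded.\<close>

lemma (in prob_space) rademacher_sum_second_moment:
  fixes I :: "'i set" and X :: "'i \<Rightarrow> 'a \<Rightarrow> real"
  defines "S \<equiv> \<lambda>\<omega>. (\<Sum>i\<in>I. X i \<omega>) / sqrt (card I)"
  assumes I: "finite I" "I \<noteq> {}" and indep: "indep_vars (\<lambda>_. borel) X I"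
    and sign: "\<And>i \<omega>. i \<in> I \<Longrightarrow> \<omega> \<in> space M \<Longrightarrow> X i \<omega> \<in> {-1, 1}"
    and mean: "\<And>i. i \<in> I \<Longrightarrow> expectation (X i) = 0"
  shows "integrable M (\<lambda>\<omega>. (S \<omega>)\<^sup>2)" "expectation (\<lambda>\<omega>. (S \<omega>)\<^sup>2) = 1"
    "integrable M S" "expectation S = 0"
proof -
  have X_rv [measurable]: "random_variable borel (X i)" if "i \<in> I" for i
    using indep that by (simp add: indep_vars_def2)
  have S_rv [measurable]: "random_variable borel S" unfolding S_def by measurable
  have bound: "\<bar>S \<omega>\<bar> \<le> card I / sqrt (card I)" if "\<omega> \<in> space M" for \<omega>
  proof -
    have "\<bar>\<Sum>i\<in>I. X i \<omega>\<bar> \<le> (\<Sum>i\<in>I. \<bar>X i \<omega>\<bar>)" by (rule sum_abs)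
    also have "\<dots> \<le> (\<Sum>i\<in>I. 1)" by (intro sum_mono) (use sign that in fastforce)
    finally show ?thesis by (simp add: S_def divide_right_mono)
  qed
  show int2: "integrable M (\<lambda>\<omega>. (S \<omega>)\<^sup>2)"
    by (rule integrable_continuous_bounded[OF S_rv bound]) (auto intro!: continuous_intros)
  show "integrable M S"
    using integrable_continuous_bounded[OF S_rv bound, of "\<lambda>x. x"] by simp
  have "integrable M (X i)" if "i \<in> I" for i
    by (rule integrable_const_bound[where B = 1]) (use sign that in \<open>fastforce+\<close>)
  then show "expectation S = 0" by (simp add: S_def mean)
  have "\<bar>expectation (\<lambda>\<omega>. S \<omega> * S \<omega> - 1)\<bar> \<le> 0 / card I"
    unfolding S_def
    by (rule rademacher_sum_stein_error[OF I indep sign mean, where f'' = "\<lambda>_. 0"])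
      (auto intro!: derivative_eq_intros)
  then show "expectation (\<lambda>\<omega>. (S \<omega>)\<^sup>2) = 1"
    using int2 prob_space by (simp add: power2_eq_square)
qed

section \<open>The product of two standard normals\<close>

text \<open>Evenness of \<open>cosh\<close> doubles the half-line integral that defines
  \<open>besselK 0\<close>. The nonnegative integral is the form that suits the later exchange of
  integrals.\<close>

lemma nn_integral_exp_cosh:
  assumes "y > 0"
  shows "(\<integral>\<^sup>+u. ennreal (exp (- y * cosh u)) \<partial>lborel) = ennreal (2 * besselK 0 y)"
proof -
  define e where "e u = exp (- y * cosh u)" for u
  \<comment> \<open>Domination by \<open>exp (- y * u)\<close> gives integrability, so
    \<open>besselK 0 y\<close> is the true integral and not a default value.\<close>
  have cosh_ge: "u \<le> cosh u" if "u \<ge> 0" for u :: real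
  proof -
    have "2 * u \<le> 1 + u + u\<^sup>2 / 2" using zero_le_power2[of "u - 1"] by (simp add: power2_eq_square algebra_simps)
    also have "\<dots> \<le> exp u" using exp_lower_Taylor_quadratic[OF that] by simp
    also have "\<dots> \<le> 2 * cosh u" by (simp add: cosh_def)
    finally show ?thesis by simp
  qed
  have [measurable]: "e \<in> borel_measurable borel"
    unfolding e_def by (intro borel_measurable_continuous_onI continuous_intros)
  have exp_int: "(\<integral>\<^sup>+u. ennreal (exp (- y * u)) * indicator {0..} u \<partial>lborel) = ennreal (exp (- y * 0) / y)"
    by (rule nn_integral_has_integral_lebesgue') (use has_integral_exp_minus_to_infinity[OF assms, of 0] in auto)
  have int: "integrable lborel (\<lambda>u. indicator {0..} u *\<^sub>R e u)"
  proof (rule integrableI_bounded)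
    have "(\<integral>\<^sup>+u. ennreal (norm (indicator {0..} u *\<^sub>R e u)) \<partial>lborel)
      \<le> (\<integral>\<^sup>+u. ennreal (exp (- y * u)) * indicator {0..} u \<partial>lborel)"
      by (intro nn_integral_mono) (use assms in \<open>auto simp: indicator_def e_def cosh_ge\<close>)
    then show "(\<integral>\<^sup>+u. ennreal (norm (indicator {0..} u *\<^sub>R e u)) \<partial>lborel) < \<infinity>"
      unfolding exp_int by (rule le_less_trans) simp
  qed simp
  have half: "(\<integral>\<^sup>+u. ennreal (e u) * indicator {0..} u \<partial>lborel) = ennreal (besselK 0 y)"
  proof -
    have "(\<integral>\<^sup>+u. ennreal (e u) * indicator {0..} u \<partial>lborel) = (\<integral>\<^sup>+u. ennreal (indicator {0..} u *\<^sub>R e u) \<partial>lborel)"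
      by (intro nn_integral_cong) (auto simp: indicator_def)
    also have "\<dots> = ennreal (LBINT u. indicator {0..} u *\<^sub>R e u)"
      by (rule nn_integral_eq_integral[OF int]) (auto simp: e_def)
    finally show ?thesis by (simp add: besselK_def set_lebesgue_integral_def e_def)
  qed
  have "(\<integral>\<^sup>+u. ennreal (e u) * indicator {..<0} u \<partial>lborel)
      = (\<integral>\<^sup>+u. ennreal (e (- u)) * indicator {..<0} (- u) \<partial>lborel)"
    by (subst nn_integral_real_affine[where c = "-1" and t = 0]) auto
  also have "\<dots> = (\<integral>\<^sup>+u. ennreal (e u) * indicator {0..} u \<partial>lborel)"
    by (rule nn_integral_cong_AE, use AE_lborel_singleton[of 0] in eventually_elim)
      (auto simp: indicator_def e_def)
  finally have other: "(\<integral>\<^sup>+u. ennreal (e u) * indicator {..<0} u \<partial>lborel) = ennreal (besselK 0 y)"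
    unfolding half .
  have "(\<integral>\<^sup>+u. ennreal (e u) \<partial>lborel)
      = (\<integral>\<^sup>+u. ennreal (e u) * indicator {0..} u + ennreal (e u) * indicator {..<0} u \<partial>lborel)"
    by (intro nn_integral_cong) (auto simp: indicator_def)
  also have "\<dots> = ennreal (besselK 0 y) + ennreal (besselK 0 y)"
    by (subst nn_integral_add) (auto simp: half other)
  also have "\<dots> = ennreal (2 * besselK 0 y)"
    by (subst ennreal_plus[symmetric])
      (auto simp: besselK_def set_lebesgue_integral_def intro!: Bochner_Integration.integral_nonneg)
  finally show ?thesis by (simp add: e_def)
qed

text \<open>Given the factor \<open>z\<close>, the product has density
  \<open>std_normal_density (x / z) / \<bar>z\<bar>\<close>. For positive \<open>z\<close> the
  substitution \<open>z = sqrt \<bar>x\<bar> * exp (u / 2)\<close> turns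
  \<open>z^2 + (x / z)^2\<close> into \<open>2 * \<bar>x\<bar> * cosh u\<close>, which produces the
  Bessel integral; negative \<open>z\<close> contribute the same amount.\<close>

lemma nn_integral_normal_product_density:
  assumes "x \<noteq> 0"
  shows "(\<integral>\<^sup>+z. ennreal (std_normal_density z * std_normal_density (x / z) / \<bar>z\<bar>) \<partial>lborel)
    = ennreal (besselK 0 \<bar>x\<bar> / pi)"
proof -
  define k where "k z = std_normal_density z * std_normal_density (x / z) / \<bar>z\<bar>" for z
  \<comment> \<open>The contribution of one half-line: the prefactor \<open>1 / (4 * pi)\<close>
    times \<open>2 * besselK 0 \<bar>x\<bar>\<close>.\<close>
  define b where "b = besselK 0 \<bar>x\<bar> / (2 * pi)"
  have k_nonneg: "k z \<ge> 0" for z by (simp add: k_def)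
  have [measurable]: "k \<in> borel_measurable borel" unfolding k_def by measurable
  have bessel_nonneg: "besselK 0 \<bar>x\<bar> \<ge> 0"
    unfolding besselK_def set_lebesgue_integral_def by (rule Bochner_Integration.integral_nonneg) auto
  define g where "g u = sqrt \<bar>x\<bar> * exp (u / 2)" for u
  have g_pos: "g u > 0" for u using assms by (simp add: g_def)
  have g2: "(g u)\<^sup>2 = \<bar>x\<bar> * exp u" for u
    by (simp add: g_def power_mult_distrib flip: exp_double)
  have xg2: "(x / g u)\<^sup>2 = \<bar>x\<bar> * exp (- u)" for u
  proof -
    have "(x / g u)\<^sup>2 = (\<bar>x\<bar> * \<bar>x\<bar>) / (\<bar>x\<bar> * exp u)"
      unfolding power_divide g2 by (simp add: power2_eq_square)
    also have "\<dots> = \<bar>x\<bar> / exp u"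
      by (rule mult_divide_mult_cancel_left) (use assms in simp)
    finally show ?thesis by (simp add: exp_minus divide_inverse)
  qed
  have dg: "(g has_real_derivative g u / 2) (at u)" for u
    unfolding g_def by (auto intro!: derivative_eq_intros)
  have range_g: "range g = {0<..}"
  proof (intro equalityI subsetI)
    fix z :: real assume "z \<in> {0<..}"
    then have "g (2 * ln (z / sqrt \<bar>x\<bar>)) = z" using assms by (simp add: g_def)
    then show "z \<in> range g" by (metis rangeI)
  qed (use g_pos in auto)
  have "inj g" using assms by (auto simp: inj_def g_def)
  have kg: "\<bar>g u / 2\<bar> * k (g u) = 1 / (4 * pi) * exp (- \<bar>x\<bar> * cosh u)" for u
  proof -
    have "\<bar>g u / 2\<bar> * k (g u) = 1 / (4 * pi) * (exp (- (g u)\<^sup>2 / 2) * exp (- (x / g u)\<^sup>2 / 2))"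
      using g_pos[of u] by (simp add: k_def std_normal_density_def real_sqrt_mult)
    also have "exp (- (g u)\<^sup>2 / 2) * exp (- (x / g u)\<^sup>2 / 2) = exp (- \<bar>x\<bar> * cosh u)"
      unfolding g2 xg2 by (simp add: mult_exp_exp cosh_def algebra_simps flip: add_divide_distrib)
    finally show ?thesis .
  qed
  have substituted: "((\<lambda>u. \<bar>g u / 2\<bar> * k (g u)) has_integral b) UNIV"
  proof (rule nn_integral_has_integral)
    have "(\<integral>\<^sup>+u. ennreal (\<bar>g u / 2\<bar> * k (g u)) \<partial>lborel)
        = (\<integral>\<^sup>+u. ennreal (1 / (4 * pi)) * ennreal (exp (- \<bar>x\<bar> * cosh u)) \<partial>lborel)"
      unfolding kg by (intro nn_integral_cong ennreal_mult) auto
    also have "\<dots> = ennreal (1 / (4 * pi)) * ennreal (2 * besselK 0 \<bar>x\<bar>)"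
      using nn_integral_exp_cosh[of "\<bar>x\<bar>"] assms
      by (subst nn_integral_cmult) (auto intro!: borel_measurable_continuous_onI continuous_intros)
    also have "\<dots> = ennreal b"
      using bessel_nonneg by (simp add: b_def flip: ennreal_mult)
    finally show "(\<integral>\<^sup>+u. ennreal (\<bar>g u / 2\<bar> * k (g u)) \<partial>lborel) = ennreal b" .
  qed (use bessel_nonneg k_nonneg in \<open>auto simp: b_def g_def\<close>)
  \<comment> \<open>The change of variables is an equivalence for absolutely integrable functions;
    nonnegativity of the integrand supplies this.\<close>
  have "(\<lambda>u. \<bar>g u / 2\<bar> * k (g u)) absolutely_integrable_on UNIV"
    by (rule nonnegative_absolutely_integrable_1[OF has_integral_integrable[OF substituted]])
      (rule mult_nonneg_nonneg[OF abs_ge_zero k_nonneg])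
  with integral_unique[OF substituted]
  have "k absolutely_integrable_on {0<..} \<and> integral {0<..} k = b"
    using has_absolute_integral_change_of_variables_1'[of UNIV g "\<lambda>u. g u / 2" k b] dg \<open>inj g\<close>
    by (simp add: range_g)
  then have "(k has_integral b) {0<..}"
    using set_lebesgue_integral_eq_integral(1) by (metis integrable_integral)
  then have pos: "(\<integral>\<^sup>+z. ennreal (k z) * indicator {0<..} z \<partial>lborel) = ennreal b"
    by (intro nn_integral_has_integral_lebesgue' k_nonneg)
  have "(\<integral>\<^sup>+z. ennreal (k z) * indicator {..<0} z \<partial>lborel)
      = (\<integral>\<^sup>+z. ennreal (k (- z)) * indicator {..<0} (- z) \<partial>lborel)"
    by (subst nn_integral_real_affine[where c = "-1" and t = 0]) auto
  also have "\<dots> = ennreal b"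
    unfolding pos[symmetric]
    by (intro nn_integral_cong) (auto simp: indicator_def k_def std_normal_density_def)
  finally have neg: "(\<integral>\<^sup>+z. ennreal (k z) * indicator {..<0} z \<partial>lborel) = ennreal b" .
  have "(\<integral>\<^sup>+z. ennreal (k z) \<partial>lborel)
      = (\<integral>\<^sup>+z. ennreal (k z) * indicator {0<..} z + ennreal (k z) * indicator {..<0} z \<partial>lborel)"
    \<comment> \<open>At \<open>z = 0\<close> both indicators vanish, and so does \<open>k\<close>,
      because division by zero yields 0.\<close>
    by (intro nn_integral_cong) (auto simp: indicator_def k_def)
  also have "\<dots> = ennreal b + ennreal b"
    by (subst nn_integral_add) (auto simp: pos neg)
  also have "\<dots> = ennreal (besselK 0 \<bar>x\<bar> / pi)"
    using bessel_nonneg by (simp add: b_def flip: ennreal_plus)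
  finally show ?thesis by (simp add: k_def)
qed

lemma measurable_besselK [measurable]: "besselK \<nu> \<in> borel_measurable borel"
  unfolding besselK_def[abs_def] set_lebesgue_integral_def cosh_def by measurable

text \<open>For fixed \<open>z \<noteq> 0\<close> the substitution \<open>w = x / z\<close> makes
  the product the integration variable. After the exchange of integrals, the inner integral over
  \<open>z\<close> is the Bessel density.\<close>

lemma distr_normal_product:
  "distr (std_normal_distribution \<Otimes>\<^sub>M std_normal_distribution) borel (\<lambda>(z, w). z * w) = VG"
proof (rule measure_eqI)
  show "sets (distr (std_normal_distribution \<Otimes>\<^sub>M std_normal_distribution) borel (\<lambda>(z, w). z * w)) = sets VG"
    by (simp add: VG_def)
  fix A assume "A \<in> sets (distr (std_normal_distribution \<Otimes>\<^sub>M std_normal_distribution) borel (\<lambda>(z, w). z * w))"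
  then have [measurable]: "A \<in> sets borel" by simp
  interpret N: real_distribution std_normal_distribution by (rule real_dist_normal_dist)
  let ?\<phi> = "\<lambda>x. ennreal (std_normal_density x)"
  have "emeasure (distr (std_normal_distribution \<Otimes>\<^sub>M std_normal_distribution) borel (\<lambda>(z, w). z * w)) A
      = (\<integral>\<^sup>+x. indicator A x \<partial>distr (std_normal_distribution \<Otimes>\<^sub>M std_normal_distribution) borel (\<lambda>(z, w). z * w))"
    by simp
  also have "\<dots> = (\<integral>\<^sup>+p. indicator A (fst p * snd p) \<partial>(std_normal_distribution \<Otimes>\<^sub>M std_normal_distribution))"
    by (subst nn_integral_distr) (auto simp: case_prod_beta)
  also have "\<dots> = (\<integral>\<^sup>+z. \<integral>\<^sup>+w. indicator A (z * w) \<partial>std_normal_distribution \<partial>std_normal_distribution)"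
    by (subst N.nn_integral_fst[symmetric]) auto
  also have "\<dots> = (\<integral>\<^sup>+z. ?\<phi> z * (\<integral>\<^sup>+w. ?\<phi> w * indicator A (z * w) \<partial>lborel) \<partial>lborel)"
    by (simp add: nn_integral_density)
  also have "\<dots> = (\<integral>\<^sup>+z. \<integral>\<^sup>+x. ennreal (std_normal_density z * std_normal_density (x / z) / \<bar>z\<bar>) * indicator A x \<partial>lborel \<partial>lborel)"
  proof (rule nn_integral_cong_AE, use AE_lborel_singleton[of 0] in eventually_elim)
    case (elim z)
    have "?\<phi> z * (\<integral>\<^sup>+w. ?\<phi> w * indicator A (z * w) \<partial>lborel)
        = ?\<phi> z * (ennreal \<bar>1 / z\<bar> * (\<integral>\<^sup>+x. ?\<phi> (x / z) * indicator A x \<partial>lborel))"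
      using elim by (subst nn_integral_real_affine[where c = "1 / z" and t = 0]) auto
    also have "\<dots> = (\<integral>\<^sup>+x. ?\<phi> z * (ennreal \<bar>1 / z\<bar> * (?\<phi> (x / z) * indicator A x)) \<partial>lborel)"
      by (simp add: nn_integral_cmult)
    also have "\<dots> = (\<integral>\<^sup>+x. ennreal (std_normal_density z * std_normal_density (x / z) / \<bar>z\<bar>) * indicator A x \<partial>lborel)"
      by (intro nn_integral_cong) (auto simp: indicator_def mult_ac simp flip: ennreal_mult)
    finally show ?case .
  qed
  also have "\<dots> = (\<integral>\<^sup>+x. \<integral>\<^sup>+z. ennreal (std_normal_density z * std_normal_density (x / z) / \<bar>z\<bar>) * indicator A x \<partial>lborel \<partial>lborel)"
    by (rule lborel_pair.Fubini') simp
  also have "\<dots> = (\<integral>\<^sup>+x. ennreal (1 / pi * besselK 0 \<bar>x\<bar>) * indicator A x \<partial>lborel)"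
    \<comment> \<open>The density formula needs \<open>x \<noteq> 0\<close>; the excluded point,
      where \<open>besselK\<close> takes its default value, is null.\<close>
    by (rule nn_integral_cong_AE, use AE_lborel_singleton[of 0] in eventually_elim)
      (simp add: nn_integral_multc nn_integral_normal_product_density)
  also have "\<dots> = emeasure VG A"
    unfolding VG_def by (subst emeasure_density) auto
  finally show "emeasure (distr (std_normal_distribution \<Otimes>\<^sub>M std_normal_distribution) borel (\<lambda>(z, w). z * w)) A = emeasure VG A" .
qed

section \<open>Products of Rademacher sums\<close>

lemma (in prob_space) expectation_fair_bit:
  fixes W :: "'a \<Rightarrow> nat"
  assumes "W \<in> measurable M (count_space {0, 1})"
    and distr: "distr M (count_space {0, 1}) W = uniform_count_measure {0, 1}"
  shows "expectation (\<lambda>\<omega>. (if W \<omega> = 0 then 1 else - 1) :: real) = 0"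
proof -
  have "expectation (\<lambda>\<omega>. (if W \<omega> = 0 then 1 else - 1) :: real)
      = (LINT k|distr M (count_space {0, 1}) W. (if k = 0 then 1 else - 1))"
    by (rule integral_distr[symmetric, OF assms(1)]) simp
  then show ?thesis unfolding distr by (simp add: integral_uniform_count_measure)
qed

text \<open>The bound on the inner integral may grow with \<open>t\<close>: a dilation by \<open>t\<close> multiplies the second
  derivative of the test function by \<open>t\<^sup>2\<close>.\<close>
lemma product_replacement_bound:
  fixes P N Q :: "real measure" and h :: "real \<Rightarrow> real"
  assumes P: "real_distribution P" and N: "real_distribution N" and Q: "real_distribution Q"
    and [measurable]: "h \<in> borel_measurable borel" and bounded: "\<And>x. \<bar>h x\<bar> \<le> H"
    and moment: "integrable Q (\<lambda>t. t\<^sup>2)" "(LINT t|Q. t\<^sup>2) = 1"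
    and close: "\<And>t. \<bar>(LINT s|P. h (s * t)) - (LINT z|N. h (z * t))\<bar> \<le> a + b * t\<^sup>2"
  shows "\<bar>(LINT p|(P \<Otimes>\<^sub>M Q). h (fst p * snd p)) - (LINT p|(N \<Otimes>\<^sub>M Q). h (fst p * snd p))\<bar> \<le> a + b"
proof -
  interpret Q: real_distribution Q by (rule Q)
  have Fubini: "integrable Q (\<lambda>t. LINT s|R. h (s * t))"
    "(LINT p|(R \<Otimes>\<^sub>M Q). h (fst p * snd p)) = (LINT t|Q. LINT s|R. h (s * t))"
    if "real_distribution R" for R
  proof -
    interpret R: real_distribution R by (rule that)
    interpret RQ: pair_prob_space R Q ..
    have int: "integrable (R \<Otimes>\<^sub>M Q) (\<lambda>(s, t). h (s * t))"
      by (rule RQ.integrable_const_bound[where B = H]) (use bounded in auto)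
    show "integrable Q (\<lambda>t. LINT s|R. h (s * t))"
      by (rule RQ.integrable_snd[OF int])
    show "(LINT p|(R \<Otimes>\<^sub>M Q). h (fst p * snd p)) = (LINT t|Q. LINT s|R. h (s * t))"
      using RQ.integral_snd[OF int] by (simp add: case_prod_unfold)
  qed
  have "\<bar>(LINT t|Q. LINT s|P. h (s * t)) - (LINT t|Q. LINT s|N. h (s * t))\<bar>
      = \<bar>LINT t|Q. (LINT s|P. h (s * t)) - (LINT s|N. h (s * t))\<bar>"
    using Fubini(1)[OF P] Fubini(1)[OF N] by simp
  also have "\<dots> \<le> (LINT t|Q. \<bar>(LINT s|P. h (s * t)) - (LINT s|N. h (s * t))\<bar>)"
    by (rule integral_abs_bound)
  also have "\<dots> \<le> (LINT t|Q. a + b * t\<^sup>2)"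
    using Fubini(1)[OF P] Fubini(1)[OF N] moment(1)
    by (intro integral_mono close) auto
  also have "\<dots> = a + b"
    using moment Q.prob_space by simp
  finally show ?thesis by (simp add: Fubini(2) P N)
qed

text \<open>Commutativity of multiplication lets the replacement bound, which acts on the first
  factor, also be used for the second.\<close>

lemma integral_pair_mult_swap:
  fixes P Q :: "real measure" and h :: "real \<Rightarrow> real"
  assumes "real_distribution P" "real_distribution Q" and [measurable]: "h \<in> borel_measurable borel"
  shows "(LINT p|(P \<Otimes>\<^sub>M Q). h (fst p * snd p)) = (LINT p|(Q \<Otimes>\<^sub>M P). h (fst p * snd p))"
proof -
  interpret P: real_distribution P by fact
  interpret Q: real_distribution Q by fact
  interpret PQ: pair_prob_space P Q ..
  have "(\<lambda>p. h (fst p * snd p)) \<in> borel_measurable (P \<Otimes>\<^sub>M Q)" by measurable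
  from PQ.integral_product_swap[OF this] show ?thesis by (simp add: case_prod_unfold mult.commute)
qed

text \<open>The normal approximation is applied to \<open>h (x * t)\<close>. The centre
  \<open>\<nu>\<close> is the same for all \<open>t\<close>, whereas the normal mean of the dilated
  function varies with \<open>t\<close>; passing between them doubles \<open>A\<close>, hence 16
  instead of 8. The second derivative gains the factor \<open>t^2\<close>.\<close>

lemma (in prob_space) rademacher_sum_dilated_normal_approximation:
  fixes I :: "'i set" and X :: "'i \<Rightarrow> 'a \<Rightarrow> real" and h h' h'' :: "real \<Rightarrow> real"
  defines "S \<equiv> \<lambda>\<omega>. (\<Sum>i\<in>I. X i \<omega>) / sqrt (card I)"
  assumes I: "finite I" "I \<noteq> {}" and indep: "indep_vars (\<lambda>_. borel) X I"
    and sign: "\<And>i \<omega>. i \<in> I \<Longrightarrow> \<omega> \<in> space M \<Longrightarrow> X i \<omega> \<in> {-1, 1}"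
    and mean: "\<And>i. i \<in> I \<Longrightarrow> expectation (X i) = 0"
    and dh: "\<And>x. (h has_real_derivative h' x) (at x)"
    and dh': "\<And>x. (h' has_real_derivative h'' x) (at x)"
    and A: "\<And>x. \<bar>h x - \<nu>\<bar> \<le> A" and B: "\<And>x. \<bar>h' x\<bar> \<le> B" and C: "\<And>x. \<bar>h'' x\<bar> \<le> C"
  shows "\<bar>(LINT s|distr M borel S. h (s * t)) - (LINT z|std_normal_distribution. h (z * t))\<bar>
    \<le> 16 * A / card I + 2 * C / card I * t\<^sup>2"
proof -
  interpret N: real_distribution std_normal_distribution by (rule real_dist_normal_dist)
  have [measurable]: "h \<in> borel_measurable borel"
    by (rule borel_measurable_continuous_onI[OF DERIV_continuous_on[OF dh]])
  have X_rv [measurable]: "random_variable borel (X i)" if "i \<in> I" for i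
    using indep that by (simp add: indep_vars_def2)
  have [measurable]: "random_variable borel S" unfolding S_def by measurable
  let ?\<mu> = "LINT z|std_normal_distribution. h (z * t)"
  have "\<bar>h x\<bar> \<le> A + \<bar>\<nu>\<bar>" for x using A[of x] by linarith
  then have int: "integrable std_normal_distribution (\<lambda>z. h (z * t))"
    by (intro N.integrable_const_bound[where B = "A + \<bar>\<nu>\<bar>"] AE_I2) auto
  have "?\<mu> - \<nu> = (LINT z|std_normal_distribution. h (z * t) - \<nu>)"
    using int N.prob_space by simp
  also have "\<bar>\<dots>\<bar> \<le> (LINT z|std_normal_distribution. \<bar>h (z * t) - \<nu>\<bar>)"
    by (rule integral_abs_bound)
  also have "\<dots> \<le> A"
    by (rule N.integral_le_const) (use int A in auto)
  finally have "\<bar>?\<mu> - \<nu>\<bar> \<le> A" .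
  then have A': "\<bar>h (x * t) - ?\<mu>\<bar> \<le> 2 * A" for x
    using A[of "x * t"] by linarith
  have d1: "((\<lambda>x. h (x * t)) has_real_derivative t * h' (x * t)) (at x)" for x
    by (rule DERIV_cong[OF DERIV_chain2[OF dh DERIV_cmult_right[OF DERIV_ident]]]) simp
  have d2: "((\<lambda>x. t * h' (x * t)) has_real_derivative t\<^sup>2 * h'' (x * t)) (at x)" for x
    by (rule DERIV_cong[OF DERIV_cmult[OF DERIV_chain2[OF dh' DERIV_cmult_right[OF DERIV_ident]]]])
      (simp add: power2_eq_square)
  have b1: "\<bar>t * h' (x * t)\<bar> \<le> \<bar>t\<bar> * B" for x by (simp add: abs_mult B mult_left_mono)
  have b2: "\<bar>t\<^sup>2 * h'' (x * t)\<bar> \<le> t\<^sup>2 * C" for x by (simp add: abs_mult C mult_left_mono)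
  have "\<bar>expectation (\<lambda>\<omega>. h (S \<omega> * t)) - ?\<mu>\<bar> \<le> (8 * (2 * A) + 2 * (t\<^sup>2 * C)) / card I"
    unfolding S_def
    by (rule rademacher_sum_normal_approximation[OF I indep sign mean d1 d2 A' b1 b2])
  then show ?thesis
    by (simp add: integral_distr add_divide_distrib mult_ac)
qed

lemma VG_expect_eq:
  assumes [measurable]: "h \<in> borel_measurable borel"
  shows "VG_expect h = (LINT p|(std_normal_distribution \<Otimes>\<^sub>M std_normal_distribution). h (fst p * snd p))"
  unfolding VG_expect_def distr_normal_product[symmetric]
  by (subst integral_distr) (auto simp: case_prod_unfold)

text \<open>A two-step exchange: independence makes the joint law of \<open>S\<close> and
  \<open>T\<close> a product, then \<open>S\<close> is replaced by a normal factor, the factors are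
  swapped, and \<open>T\<close> is replaced. The factor kept fixed, first \<open>T\<close> and then
  a normal variable, has second moment 1, which integrates the \<open>t^2\<close> term.\<close>

theorem (in prob_space) rademacher_product_VG_approximation:
  fixes I :: "'i set" and J :: "'j set" and X :: "'i \<Rightarrow> 'a \<Rightarrow> real" and Y :: "'j \<Rightarrow> 'a \<Rightarrow> real"
    and h h' h'' :: "real \<Rightarrow> real"
  defines "S \<equiv> \<lambda>\<omega>. (\<Sum>i\<in>I. X i \<omega>) / sqrt (card I)"
    and "T \<equiv> \<lambda>\<omega>. (\<Sum>j\<in>J. Y j \<omega>) / sqrt (card J)"
  assumes I: "finite I" "I \<noteq> {}" and indepX: "indep_vars (\<lambda>_. borel) X I"
    and signX: "\<And>i \<omega>. i \<in> I \<Longrightarrow> \<omega> \<in> space M \<Longrightarrow> X i \<omega> \<in> {-1, 1}"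
    and meanX: "\<And>i. i \<in> I \<Longrightarrow> expectation (X i) = 0"
    and J: "finite J" "J \<noteq> {}" and indepY: "indep_vars (\<lambda>_. borel) Y J"
    and signY: "\<And>j \<omega>. j \<in> J \<Longrightarrow> \<omega> \<in> space M \<Longrightarrow> Y j \<omega> \<in> {-1, 1}"
    and meanY: "\<And>j. j \<in> J \<Longrightarrow> expectation (Y j) = 0"
    and indep: "indep_var borel S borel T"
    and dh: "\<And>x. (h has_real_derivative h' x) (at x)"
    and dh': "\<And>x. (h' has_real_derivative h'' x) (at x)"
    and A: "\<And>x. \<bar>h x - VG_expect h\<bar> \<le> A" and B: "\<And>x. \<bar>h' x\<bar> \<le> B" and C: "\<And>x. \<bar>h'' x\<bar> \<le> C"
  shows "\<bar>expectation (\<lambda>\<omega>. h (S \<omega> * T \<omega>)) - VG_expect h\<bar>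
    \<le> (16 * A + 2 * C) / card I + (16 * A + 2 * C) / card J"
proof -
  let ?N = std_normal_distribution
  have N: "real_distribution ?N" by (rule real_dist_normal_dist)
  have [measurable]: "h \<in> borel_measurable borel"
    by (rule borel_measurable_continuous_onI[OF DERIV_continuous_on[OF dh]])
  have h_bound: "\<bar>h x\<bar> \<le> A + \<bar>VG_expect h\<bar>" for x using A[of x] by linarith
  have S_rv [measurable]: "random_variable borel S" using indep by (rule indep_var_rv1)
  have T_rv [measurable]: "random_variable borel T" using indep by (rule indep_var_rv2)
  define P where "P = distr M borel S"
  define Q where "Q = distr M borel T"
  have P: "real_distribution P" and Q: "real_distribution Q"
    unfolding P_def Q_def by (rule real_distribution_distr; measurable)+
  have momentQ: "integrable Q (\<lambda>t. t\<^sup>2)" "(LINT t|Q. t\<^sup>2) = 1"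
    using rademacher_sum_second_moment[OF J indepY signY meanY]
    by (simp_all add: Q_def integrable_distr_eq integral_distr T_def)
  have momentN: "integrable ?N (\<lambda>t. t\<^sup>2)" "(LINT t|?N. t\<^sup>2) = 1"
    using std_normal_distribution_even_moments[of 1] by simp_all
  have "\<bar>(LINT p|(P \<Otimes>\<^sub>M Q). h (fst p * snd p)) - (LINT p|(?N \<Otimes>\<^sub>M Q). h (fst p * snd p))\<bar>
      \<le> 16 * A / card I + 2 * C / card I"
    by (rule product_replacement_bound[OF P N Q _ h_bound momentQ])
      (use rademacher_sum_dilated_normal_approximation[OF I indepX signX meanX dh dh' A B C]
        in \<open>simp_all add: P_def S_def\<close>)
  moreover have "\<bar>(LINT p|(Q \<Otimes>\<^sub>M ?N). h (fst p * snd p)) - (LINT p|(?N \<Otimes>\<^sub>M ?N). h (fst p * snd p))\<bar>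
      \<le> 16 * A / card J + 2 * C / card J"
    by (rule product_replacement_bound[OF Q N N _ h_bound momentN])
      (use rademacher_sum_dilated_normal_approximation[OF J indepY signY meanY dh dh' A B C]
        in \<open>simp_all add: Q_def T_def\<close>)
  moreover have "(LINT p|(?N \<Otimes>\<^sub>M Q). h (fst p * snd p)) = (LINT p|(Q \<Otimes>\<^sub>M ?N). h (fst p * snd p))"
    by (rule integral_pair_mult_swap[OF N Q]) simp
  moreover have "expectation (\<lambda>\<omega>. h (S \<omega> * T \<omega>)) = (LINT p|(P \<Otimes>\<^sub>M Q). h (fst p * snd p))"
  proof -
    have "P \<Otimes>\<^sub>M Q = distr M (borel \<Otimes>\<^sub>M borel) (\<lambda>\<omega>. (S \<omega>, T \<omega>))"
      using indep unfolding indep_var_distribution_eq P_def Q_def by blast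
    then show ?thesis by (simp add: integral_distr)
  qed
  ultimately show ?thesis
    by (simp add: VG_expect_eq add_divide_distrib)
qed

section \<open>Reduction of the letter statistic to a product of Rademacher sums\<close>

lemma sup_norm_upper:
  assumes "bounded (range f)"
  shows "\<bar>f x\<bar> \<le> sup_norm f"
  unfolding sup_norm_def
  using assms by (intro cSUP_upper) (auto simp: bounded_iff bdd_above_def)

lemma Cb_has_real_derivative:
  assumes "h \<in> Cb k" "i < k"
  shows "((deriv ^^ i) h has_real_derivative (deriv ^^ Suc i) h x) (at x)"
proof -
  have "(deriv ^^ i) h differentiable at x" using assms by (simp add: Cb_def)
  then have "(deriv ^^ i) h field_differentiable at x"
    by (simp add: real_differentiable_def field_differentiable_def)
  then show ?thesis using DERIV_deriv_iff_field_differentiable by fastforce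
qed

text \<open>With \<open>x = 2 * X - m\<close> and \<open>y = 2 * Y - n\<close>, the surpluses of
  zeros over ones, \<open>X * Y + (m - X) * (n - Y) = (m * n + x * y) / 2\<close>.\<close>

lemma D2_eq:
  fixes U V :: "nat \<Rightarrow> 'a \<Rightarrow> nat"
  assumes "m \<ge> 1" "n \<ge> 1"
  defines "Z \<equiv> \<lambda>s \<omega>. if case_sum U V s \<omega> = 0 then 1 else - 1 :: real"
    and "I \<equiv> Inl ` {..<m}" and "J \<equiv> Inr ` {..<n}"
  shows "D2 m n U V \<omega> = real m * real n / 2 + sqrt (real m * real n) / 2 *
    (((\<Sum>i\<in>I. Z i \<omega>) / sqrt (card I)) * ((\<Sum>j\<in>J. Z j \<omega>) / sqrt (card J)))"
proof -
  have count: "(\<Sum>i<k. if W i \<omega> = 0 then 1 else - 1 :: real) = 2 * real (zero_count k W \<omega>) - real k"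
    for k and W :: "nat \<Rightarrow> 'a \<Rightarrow> nat"
  proof -
    have "(\<Sum>i<k. if W i \<omega> = 0 then 1 else - 1 :: real) = (\<Sum>i<k. 2 * of_bool (W i \<omega> = 0) - 1)"
      by (intro sum.cong) auto
    moreover have "{..<k} \<inter> {i. W i \<omega> = 0} = {i. i < k \<and> W i \<omega> = 0}" by auto
    ultimately show ?thesis
      by (simp add: sum_subtractf zero_count_def flip: sum_distrib_left)
  qed
  have sums: "(\<Sum>i\<in>I. Z i \<omega>) = 2 * real (zero_count m U \<omega>) - real m"
    "(\<Sum>j\<in>J. Z j \<omega>) = 2 * real (zero_count n V \<omega>) - real n"
    unfolding I_def J_def Z_def by (simp_all add: sum.reindex count)
  have cards: "card I = m" "card J = n" unfolding I_def J_def by (simp_all add: card_image)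
  have scaled: "sqrt (real m * real n) / 2 * (x / sqrt (card I) * (y / sqrt (card J))) = x * y / 2" for x y
    using assms(1,2) by (simp add: cards real_sqrt_mult)
  show ?thesis
    unfolding sums D2_def Let_def scaled by (simp add: field_simps)
qed

theorem theorem4p12:
  fixes M :: "'a measure" and m n :: nat
    and U V :: "nat \<Rightarrow> 'a \<Rightarrow> nat" and h :: "real \<Rightarrow> real"
  assumes "prob_space M"
    and "m \<ge> 1" and "n \<ge> 1"
    and "uniform_binary_sequences M m n U V"
    and "h \<in> Cb 3"
  shows "\<bar>prob_space.expectation M (\<lambda>\<omega>. h (standardized M (D2 m n U V) \<omega>)) - VG_expect h\<bar>
    \<le> min (9 / real m * M3 h + 1 / real n * M4 h)
          (9 / real n * M3 h + 1 / real m * M4 h)"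
proof -
  interpret prob_space M by fact
  \<comment> \<open>One index set for all letters: their mutual independence yields independence
    within each sequence and between \<open>S\<close> and \<open>T\<close>.\<close>
  define K where "K = {..<m} <+> {..<n}"
  define I where "I = (Inl ` {..<m} :: (nat + nat) set)"
  define J where "J = (Inr ` {..<n} :: (nat + nat) set)"
  define Z where "Z s \<omega> = (if case_sum U V s \<omega> = 0 then 1 else - 1 :: real)" for s \<omega>
  define S where "S \<omega> = (\<Sum>i\<in>I. Z i \<omega>) / sqrt (card I)" for \<omega>
  define T where "T \<omega> = (\<Sum>j\<in>J. Z j \<omega>) / sqrt (card J)" for \<omega>
  have K: "K = I \<union> J" "I \<inter> J = {}" by (auto simp: K_def I_def J_def)
  have finite: "finite I" "I \<noteq> {}" "finite J" "J \<noteq> {}"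
    using assms(2,3) by (auto simp: I_def J_def lessThan_empty_iff)
  have cards: "card I = m" "card J = n" by (simp_all add: I_def J_def card_image)
  have letters: "indep_vars (\<lambda>_. count_space {0, 1}) (case_sum U V) K"
    using assms(4) by (simp add: uniform_binary_sequences_def K_def)
  have indepZ: "indep_vars (\<lambda>_. borel) Z K"
    unfolding Z_def[abs_def]
    by (rule indep_vars_compose2[OF letters, where Y = "\<lambda>_ k. if k = 0 then 1 else - 1"]) simp
  have indepI: "indep_vars (\<lambda>_. borel) Z I" and indepJ: "indep_vars (\<lambda>_. borel) Z J"
    using indep_vars_subset[OF indepZ] K by auto
  have sign: "Z s \<omega> \<in> {-1, 1}" for s \<omega> by (simp add: Z_def)
  have mean: "expectation (Z s) = 0" if "s \<in> K" for s
    unfolding Z_def[abs_def]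
  proof (rule expectation_fair_bit)
    show "random_variable (count_space {0, 1}) (case_sum U V s)"
      using letters that by (simp add: indep_vars_def2)
    show "distr M (count_space {0, 1}) (case_sum U V s) = uniform_count_measure {0, 1}"
      using assms(4) that by (auto simp: uniform_binary_sequences_def K_def)
  qed
  have indep: "indep_var borel S borel T"
  proof -
    have "indep_var borel ((\<lambda>z. (\<Sum>i\<in>I. z i) / sqrt (card I)) \<circ> (\<lambda>\<omega>. restrict (\<lambda>i. Z i \<omega>) I))
      borel ((\<lambda>z. (\<Sum>j\<in>J. z j) / sqrt (card J)) \<circ> (\<lambda>\<omega>. restrict (\<lambda>i. Z i \<omega>) J))"
      by (rule indep_var_compose[OF indep_var_restrict[OF indepZ K(2)]]) (use K in auto)
    then show ?thesis by (simp add: comp_def S_def[abs_def] T_def[abs_def])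
  qed
  have IK: "i \<in> K" if "i \<in> I" for i using that K by auto
  have JK: "j \<in> K" if "j \<in> J" for j using that K by auto
  have momentsS: "integrable M (\<lambda>\<omega>. (S \<omega>)\<^sup>2)" "expectation (\<lambda>\<omega>. (S \<omega>)\<^sup>2) = 1"
    "integrable M S" "expectation S = 0"
    unfolding S_def[abs_def]
    by (rule rademacher_sum_second_moment[OF finite(1,2) indepI sign mean[OF IK]]; assumption)+
  have momentsT: "integrable M (\<lambda>\<omega>. (T \<omega>)\<^sup>2)" "expectation (\<lambda>\<omega>. (T \<omega>)\<^sup>2) = 1"
    "integrable M T" "expectation T = 0"
    unfolding T_def[abs_def]
    by (rule rademacher_sum_second_moment[OF finite(3,4) indepJ sign mean[OF JK]]; assumption)+
  have ST: "integrable M (\<lambda>\<omega>. S \<omega> * T \<omega>)" "expectation (\<lambda>\<omega>. S \<omega> * T \<omega>) = 0"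
    using indep_var_integrable[OF indep] indep_var_lebesgue_integral[OF indep] momentsS momentsT
    by auto
  have "indep_var borel (\<lambda>\<omega>. (S \<omega>)\<^sup>2) borel (\<lambda>\<omega>. (T \<omega>)\<^sup>2)"
    using indep_var_compose[OF indep, of "\<lambda>x. x\<^sup>2" borel "\<lambda>x. x\<^sup>2" borel] by (simp add: comp_def)
  from indep_var_lebesgue_integral[OF this]
  have ST2: "expectation (\<lambda>\<omega>. (S \<omega> * T \<omega>)\<^sup>2) = 1"
    using momentsS momentsT by (simp add: power_mult_distrib)
  have D2: "D2 m n U V \<omega> = real m * real n / 2 + sqrt (real m * real n) / 2 * (S \<omega> * T \<omega>)" for \<omega>
    using D2_eq[OF assms(2,3)] by (simp add: S_def T_def Z_def I_def J_def)
  have ED: "expectation (D2 m n U V) = real m * real n / 2"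
    using ST prob_space by (simp add: D2[abs_def])
  \<comment> \<open>As \<open>S * T\<close> has mean 0 and second moment 1, the factor
    \<open>sqrt (m * n) / 2\<close> in front of it is the standard deviation of \<open>D2\<close>.
    Standardising therefore gives exactly \<open>S * T\<close>.\<close>
  have "variance (D2 m n U V) = expectation (\<lambda>\<omega>. (sqrt (real m * real n) / 2)\<^sup>2 * (S \<omega> * T \<omega>)\<^sup>2)"
    unfolding ED D2 by (simp add: power_mult_distrib power_divide)
  also have "\<dots> = (sqrt (real m * real n) / 2)\<^sup>2"
    using ST2 by simp
  finally have W: "standardized M (D2 m n U V) \<omega> = S \<omega> * T \<omega>" for \<omega>
    unfolding standardized_def ED using assms(2,3) by (simp add: D2)
  define A where "A = sup_norm (\<lambda>x. h x - VG_expect h)"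
  define B where "B = sup_norm (deriv h)"
  define C where "C = sup_norm ((deriv ^^ 2) h)"
  define E where "E = sup_norm ((deriv ^^ 3) h)"
  have bounded: "bounded (range ((deriv ^^ i) h))" if "i \<le> 3" for i
    using assms(5) that by (auto simp: Cb_def)
  have "bounded (range (\<lambda>x. h x - VG_expect h))"
    using bounded_translation[OF bounded[of 0], of "- VG_expect h"] by (simp add: image_image)
  then have A: "\<bar>h x - VG_expect h\<bar> \<le> A" for x unfolding A_def by (rule sup_norm_upper)
  have B: "\<bar>deriv h x\<bar> \<le> B" for x unfolding B_def using bounded[of 1] by (intro sup_norm_upper) simp
  have C: "\<bar>(deriv ^^ 2) h x\<bar> \<le> C" for x unfolding C_def by (intro sup_norm_upper bounded) simp
  have E: "\<bar>(deriv ^^ 3) h x\<bar> \<le> E" for x unfolding E_def by (intro sup_norm_upper bounded) simp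
  have nonneg: "A \<ge> 0" "B \<ge> 0" "C \<ge> 0" "E \<ge> 0"
    using order_trans[OF abs_ge_zero A[of 0]] order_trans[OF abs_ge_zero B[of 0]]
      order_trans[OF abs_ge_zero C[of 0]] order_trans[OF abs_ge_zero E[of 0]] by auto
  have dh: "(h has_real_derivative deriv h x) (at x)"
    and dh': "(deriv h has_real_derivative (deriv ^^ 2) h x) (at x)" for x
    using Cb_has_real_derivative[OF assms(5), of 0] Cb_has_real_derivative[OF assms(5), of 1]
    by (simp_all add: numeral_2_eq_2)
  define D where "D = 16 * A + 2 * C"
  have "\<bar>expectation (\<lambda>\<omega>. h (S \<omega> * T \<omega>)) - VG_expect h\<bar> \<le> D / card I + D / card J"
    unfolding D_def S_def T_def
    by (rule rademacher_product_VG_approximation[OF finite(1,2) indepI sign mean[OF IK]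
          finite(3,4) indepJ sign mean[OF JK] indep[unfolded S_def[abs_def] T_def[abs_def]] dh dh' A B C])
  then have main: "\<bar>expectation (\<lambda>\<omega>. h (standardized M (D2 m n U V) \<omega>)) - VG_expect h\<bar> \<le> D / m + D / n"
    by (simp add: W cards)
  have scale: "x \<le> (sqrt (pi / 2) + 1) * x" if "x \<ge> 0" for x
    using that by (simp add: distrib_right)
  \<comment> \<open>Coefficientwise comparison: 16 and 2 are below \<open>9 * 19\<close> and
    \<open>9 * 5\<close>, and below 124 and 52.\<close>
  have "D \<le> 9 * (5 * C + 18 * B + 19 * A)" "D \<le> 8 * E + 52 * C + 124 * B + 124 * A"
    using nonneg unfolding D_def by simp_all
  moreover have "5 * C + 18 * B + 19 * A \<le> M3 h"
    unfolding M3_def A_def[symmetric] B_def[symmetric] C_def[symmetric]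
    by (rule scale) (use nonneg in simp)
  moreover have "8 * E + 52 * C + 124 * B + 124 * A \<le> M4 h"
    unfolding M4_def A_def[symmetric] B_def[symmetric] C_def[symmetric] E_def[symmetric]
    by (rule scale) (use nonneg in simp)
  ultimately have "D \<le> 9 * M3 h" "D \<le> M4 h" by auto
  then have "D / k \<le> 9 / real k * M3 h" "D / k \<le> 1 / real k * M4 h" for k
    using divide_right_mono[of D _ "real k"] by auto
  \<comment> \<open>The error is symmetric in \<open>m\<close> and \<open>n\<close>, so either
    sequence length can be paired with \<open>M3\<close> and the other with
    \<open>M4\<close>.\<close>
  then have "D / m + D / n \<le> 9 / real m * M3 h + 1 / real n * M4 h"
    "D / n + D / m \<le> 9 / real n * M3 h + 1 / real m * M4 h"
    by (auto intro: add_mono)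
  with main show ?thesis by linarith
qed

end
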